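(* Let $f\in C[0,1]$. For $n\ge 3$ and $x\in[0,1]$, $$\left|D^{M,2}_n(f;x)-f(x)\right|\le 2M_2(x,n)\,\omega\big(f,\delta_n(x)\big),$$ where $M_2(x,n)=\sum_{j=0}^2|a_j(x,n)|$ and $\delta_n(x)\ge 0$ is given by $$\delta_n^2(x)=\begin{cases}\dfrac{(6-17x+12x^2)+n\varphi^2(x)}{(n+2)(n+3)}, & 0\le x\le1/2,\\[2mm] \dfrac{(1-7x+12x^2)+n\varphi^2(x)}{(n+2)(n+3)}, & 1/2\le x\le1.\end{cases}$$ Moreover, if the sequences $a_j(x,n)$, $j=0,1,2$, are bounded, then there is a constant $C$ such that $$\left|D^{M,2}_n(f;x)-f(x)\right|\le C\,\omega\left(f,\sqrt{\frac{\varphi^2(x)}{n}}\right).$$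
   Context: Here $\varphi^2(x)=x(1-x)$; $p_{n,k}(x)=\binom{n}{k}x^k(1-x)^{n-k}$ for $0\le k\le n$, and $p_{n,k}(x)=0$ if $k<0$ or $k>n$. With real sequences $a_n,b_n,c_n,d_n$ put $a_0(x,n)=a_n+b_nx+c_nx^2$, $a_1(x,n)=d_nx(1-x)$, $a_2(x,n)=a_0(1-x,n)$, and assume $a_0(x,n)+a_1(x,n)+a_2(x,n)=1$ (equivalently $D^{M,2}_n(1;x)=1$). For $n\ge3$, $$D^{M,2}_n(f;x)=\sum_{j=0}^2 a_j(x,n)A_j(f;x),\qquad A_j(f;x)=(n+1)\sum_{k=0}^n p_{n-2,k-j}(x)\int_0^1p_{n,k}(u)f(u)\,du .$$ $\omega(f,\delta)=\sup\{|f(s)-f(t)|:s,t\in[0,1],\ |s-t|\le\delta\}$ is the modulus of continuity.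
   Formalization: The second estimate is proved for x in any compact [α,β] inside (0,1), with a_j bounded there and C depending on α, β but not on f, n, x; at x=0 it fails (f(u)=u, a_0=(1-x)^2, a_1=2x(1-x), a_2=x^2), and no C is uniform on (0,1). *)

theory Defs
  imports "HOL-Analysis.Analysis"
begin

definition phi2 :: "real \<Rightarrow> real" where
  "phi2 x = x * (1 - x)"

(* The index k is an integer so that k - j may be negative. *)
definition p :: "nat \<Rightarrow> int \<Rightarrow> real \<Rightarrow> real" where
  "p n k x = (if 0 \<le> k \<and> k \<le> int n then Bernstein n (nat k) x else 0)"

definition a0 :: "(nat \<Rightarrow> real) \<Rightarrow> (nat \<Rightarrow> real) \<Rightarrow> (nat \<Rightarrow> real) \<Rightarrow> real \<Rightarrow> nat \<Rightarrow> real" where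
  "a0 a b c x n = a n + b n * x + c n * x\<^sup>2"

definition a1 :: "(nat \<Rightarrow> real) \<Rightarrow> real \<Rightarrow> nat \<Rightarrow> real" where
  "a1 d x n = d n * x * (1 - x)"

(* Only the indices j = 0, 1, 2 are used. *)
definition coef ::
  "(nat \<Rightarrow> real) \<Rightarrow> (nat \<Rightarrow> real) \<Rightarrow> (nat \<Rightarrow> real) \<Rightarrow> (nat \<Rightarrow> real) \<Rightarrow> nat \<Rightarrow> real \<Rightarrow> nat \<Rightarrow> real" where
  "coef a b c d j x n =
     (if j = 0 then a0 a b c x n
      else if j = 1 then a1 d x n
      else a0 a b c (1 - x) n)"

(* Used for n \<ge> 3 only, so the natural-number subtraction n - 2 is exact. *)
definition A_op :: "nat \<Rightarrow> nat \<Rightarrow> (real \<Rightarrow> real) \<Rightarrow> real \<Rightarrow> real" where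
  "A_op n j f x =
     (real n + 1) *
     (\<Sum>k=0..n. p (n - 2) (int k - int j) x * integral {0..1} (\<lambda>u. p n (int k) u * f u))"

definition D_op ::
  "(nat \<Rightarrow> real) \<Rightarrow> (nat \<Rightarrow> real) \<Rightarrow> (nat \<Rightarrow> real) \<Rightarrow> (nat \<Rightarrow> real) \<Rightarrow> nat \<Rightarrow> (real \<Rightarrow> real) \<Rightarrow> real \<Rightarrow> real" where
  "D_op a b c d n f x = (\<Sum>j=0..2. coef a b c d j x n * A_op n j f x)"

definition M2 ::
  "(nat \<Rightarrow> real) \<Rightarrow> (nat \<Rightarrow> real) \<Rightarrow> (nat \<Rightarrow> real) \<Rightarrow> (nat \<Rightarrow> real) \<Rightarrow> real \<Rightarrow> nat \<Rightarrow> real" where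
  "M2 a b c d x n = (\<Sum>j=0..2. \<bar>coef a b c d j x n\<bar>)"

(* Modulus of continuity on [0,1]; the supremum is the intended one for f bounded on [0,1]
   and \<delta> \<ge> 0. *)
definition modcont :: "(real \<Rightarrow> real) \<Rightarrow> real \<Rightarrow> real" where
  "modcont f \<delta> = Sup {\<bar>f s - f t\<bar> | s t. s \<in> {0..1} \<and> t \<in> {0..1} \<and> \<bar>s - t\<bar> \<le> \<delta>}"

(* The radicand is positive for n \<ge> 3 and x in [0,1], and its two branches agree at x = 1/2. *)
definition delta :: "nat \<Rightarrow> real \<Rightarrow> real" where
  "delta n x = sqrt
     ((if x \<le> 1/2 then (6 - 17 * x + 12 * x\<^sup>2) + real n * phi2 x
       else (1 - 7 * x + 12 * x\<^sup>2) + real n * phi2 x)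
      / ((real n + 2) * (real n + 3)))"

end

theory Submission
  imports Defs
begin

text \<open>
  Each \<open>A\<^sub>j(f;x)\<close> integrates \<open>f\<close> against a probability density \<open>K\<close> on \<open>[0,1]\<close> whose second
  moment about \<open>x\<close> is at most \<open>2 \<delta>\<^sup>2\<close>. With \<open>s = |u - x| / \<delta>\<close> one has
  \<open>|f u - f x| \<le> \<lceil>s\<rceil> \<omega>(f,\<delta>)\<close>, so the constant \<open>2\<close> amounts to the mean of \<open>\<lceil>s\<rceil>\<close>
  being at most \<open>2\<close>. The second moment alone only gives \<open>7/3\<close>. The missing
  information is the growth bound \<open>(u - x) K'(u) \<le> 2 K(u)\<close>, that is, \<open>K(u) / (u - x)\<^sup>2\<close>
  decreases with the distance from \<open>x\<close>. Given it, integrating by parts against a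
  suitable nonnegative weight shows that \<open>\<lceil>s\<rceil>\<close> has a mean no larger than
  \<open>4/3 + s\<^sup>2/3\<close>, whose mean is at most \<open>2\<close>. Since \<open>u (1 - u) K'(u)\<close> is \<open>K(u)\<close> times the mean of
  \<open>k - n u\<close> under the weights \<open>p\<^bsub>n-2,k-j\<^esub>(x) p\<^bsub>n,k\<^esub>(u)\<close>, the growth bound is an upper bound
  for a posterior mean, which follows from the two-term recurrence of these
  weights and Jensen's inequality.
\<close>

section \<open>Bernstein basis polynomials\<close>

lemma p_of_nat: "k \<le> n \<Longrightarrow> p n (int k) x = Bernstein n k x"
  by (simp add: p_def)

lemma p_outside: "k < 0 \<or> int n < k \<Longrightarrow> p n k x = 0"
  by (auto simp: p_def)

lemma p_nonneg: "x \<in> {0..1} \<Longrightarrow> 0 \<le> p n k x"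
  by (simp add: p_def Bernstein_nonneg)

text \<open>Binomial absorption. Letting \<open>k\<close> range over all integers spares boundary
  cases later: at \<open>k = 0\<close> the factor \<open>k\<close> kills the left side and
  \<open>p n (-1) x = 0\<close> the right one.\<close>

lemma p_shift_up: "of_int k * p (Suc n) k x = real (Suc n) * x * p n (k - 1) x"
proof (cases "1 \<le> k \<and> k \<le> int (Suc n)")
  case True
  then obtain i where i: "k = int (Suc i)" "i \<le> n"
    by (metis Suc_le_mono int_one_le_iff_zero_less nat_le_iff of_nat_le_iff zero_less_imp_eq_int Suc_pred)
  have eq: "real (Suc i) * real (Suc n choose Suc i) = real (Suc n) * real (n choose i)"
    using Suc_times_binomial[of i n] by (metis of_nat_mult)
  have "of_int k * p (Suc n) k x =
      (real (Suc i) * real (Suc n choose Suc i)) * x ^ Suc i * (1 - x) ^ (n - i)"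
    using i by (simp add: p_def Bernstein_def nat_add_distrib del: binomial_Suc_Suc)
  also have "\<dots> = real (Suc n) * x * p n (k - 1) x"
    unfolding eq using i by (simp add: p_def Bernstein_def)
  finally show ?thesis .
next
  case False
  then consider "k = 0" | "k < 0 \<or> int (Suc n) < k" by linarith
  then show ?thesis by cases (auto simp: p_outside)
qed

lemma p_reflect: "p n (int n - k) (1 - x) = p n k x"
proof (cases "0 \<le> k \<and> k \<le> int n")
  case True
  then obtain i where i: "k = int i" "i \<le> n" by (metis nonneg_int_cases of_nat_le_iff)
  then have "nat (int n - int i) = n - i" by simp
  then show ?thesis using i by (simp add: p_def Bernstein_def binomial_symmetric[of i n])
qed (auto simp: p_def)

text \<open>Mirror image of \<open>p_shift_up\<close> under reversal of the index and
  \<open>x\<close> to \<open>1 - x\<close>.\<close>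

lemma p_shift_down: "(real (Suc n) - of_int k) * p (Suc n) k x = real (Suc n) * (1 - x) * p n k x"
proof -
  have "int (Suc n) - k - 1 = int n - k" by simp
  then show ?thesis
    using p_shift_up[of "int (Suc n) - k" n "1 - x"] p_reflect[of "Suc n" k x] p_reflect[of n k x]
    by simp
qed

text \<open>The ratio of neighbouring basis polynomials, kept free of division: the common term
  \<open>p m (k - 1) x\<close> is eliminated between the two shift identities.\<close>

lemma p_step:
  assumes "n > 0"
  shows "of_int k * (1 - x) * p n k x = x * (real n - of_int k + 1) * p n (k - 1) x"
proof -
  obtain m where m: "n = Suc m" using assms by (cases n) auto
  have "of_int k * (1 - x) * p n k x = (1 - x) * (of_int k * p n k x)" by simp
  also have "\<dots> = x * (real (Suc m) * (1 - x) * p m (k - 1) x)"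
    unfolding m p_shift_up by simp
  also have "\<dots> = x * ((real (Suc m) - of_int (k - 1)) * p (Suc m) (k - 1) x)"
    unfolding p_shift_down ..
  finally show ?thesis by (simp add: m algebra_simps)
qed

lemma DERIV_Bernstein:
  "(Bernstein (Suc n) (Suc i) has_real_derivative
     real (Suc n) * (Bernstein n i x - Bernstein n (Suc i) x)) (at x)" if "i \<le> n"
proof -
  have c1: "real (Suc n choose Suc i) * (1 + real i) = (1 + real n) * real (n choose i)"
    using Suc_times_binomial[of i n] by (metis mult.commute of_nat_Suc of_nat_mult add.commute)
  have "(Suc n - Suc i) * (Suc n choose Suc i) = Suc n * (n choose Suc i)"
    using binomial_absorb_comp[of "Suc n" "Suc i"] by simp
  then have c2: "real (n - i) * real (Suc n choose Suc i) = (1 + real n) * real (n choose Suc i)"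
    by (metis diff_Suc_Suc of_nat_Suc of_nat_mult)
  \<comment> \<open>For \<open>i = n\<close> the exponent \<open>n - Suc i\<close> is truncated to
    0; this is harmless because the coefficient \<open>n - i\<close> vanishes.\<close>
  have "((\<lambda>x. real (Suc n choose Suc i) * x ^ Suc i * (1 - x) ^ (Suc n - Suc i)) has_real_derivative
      (real (Suc n choose Suc i) * (1 + real i)) * x ^ i * (1 - x) ^ (n - i) -
      (real (n - i) * real (Suc n choose Suc i)) * x ^ Suc i * (1 - x) ^ (n - Suc i)) (at x)"
    by (rule derivative_eq_intros refl | simp add: algebra_simps)+
  then show ?thesis
    unfolding c1 c2 Bernstein_def[abs_def] by (simp add: algebra_simps)
qed

lemma DERIV_p:
  "(p (Suc n) k has_real_derivative real (Suc n) * (p n (k - 1) x - p n k x)) (at x)"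
proof -
  consider "k < 0" | "int (Suc n) < k" | "k = 0" | i where "k = int (Suc i)" "i \<le> n"
    by (metis (no_types) Suc_le_mono linorder_neqE not_le of_nat_le_iff zero_less_imp_eq_int Suc_pred int_one_le_iff_zero_less
        nat_le_iff)
  then show ?thesis
  proof cases
    case 1
    then have "p (Suc n) k = (\<lambda>_. 0)" by (auto simp: p_outside)
    with 1 show ?thesis by (simp add: p_outside)
  next
    case 2
    then have "p (Suc n) k = (\<lambda>_. 0)" by (auto simp: p_outside)
    with 2 show ?thesis by (simp add: p_outside)
  next
    case 3
    have "((\<lambda>x. (1 - x) ^ Suc n) has_real_derivative - ((1 + real n) * (1 - x) ^ n)) (at x)"
      by (rule derivative_eq_intros refl | simp)+
    with 3 show ?thesis by (simp add: p_def[abs_def] Bernstein_def)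
  next
    case 4
    have "p (Suc n) k = Bernstein (Suc n) (Suc i)" unfolding 4(1) using 4(2) by (intro ext p_of_nat) simp
    moreover have "p n (k - 1) x = Bernstein n i x" using 4 by (simp add: p_def)
    moreover have "p n k x = Bernstein n (Suc i) x"
      using 4 by (cases "Suc i \<le> n")
        (auto simp: p_of_nat p_outside Bernstein_def simp del: of_nat_Suc)
    ultimately show ?thesis using DERIV_Bernstein[of i n x] 4 by simp
  qed
qed

section \<open>Continuity and integrals of the basis polynomials\<close>

lemma continuous_on_p: "continuous_on S (p n k)"
  by (cases "0 \<le> k \<and> k \<le> int n")
    (auto simp: p_def[abs_def] Bernstein_def intro!: continuous_intros)

text \<open>By \<open>DERIV_p\<close>, neighbouring basis polynomials differ by a multiple of the
  derivative of \<open>p (Suc n) k\<close>, which for \<open>0 < k <= n\<close> vanishes at both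
  endpoints. So all the integrals agree, and \<open>k = 0\<close> supplies their value.\<close>

lemma has_integral_p:
  assumes "k \<le> n"
  shows "(p n (int k) has_integral 1 / (real n + 1)) {0..1}"
  using assms
proof (induction k)
  have FTC: "((\<lambda>u. real (Suc n) * (p n (int k - 1) u - p n (int k) u)) has_integral
      p (Suc n) (int k) 1 - p (Suc n) (int k) 0) {0..1}" for k
    by (intro fundamental_theorem_of_calculus)
      (simp_all only: has_real_derivative_iff_has_vector_derivative[symmetric]
        has_field_derivative_at_within[OF DERIV_p] zero_le_one)
  {
    case 0
    have "((\<lambda>u. (-1 / (real n + 1)) * (real (Suc n) * (p n (int 0 - 1) u - p n (int 0) u)))
        has_integral (-1 / (real n + 1)) * (p (Suc n) (int 0) 1 - p (Suc n) (int 0) 0)) {0..1}"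
      by (intro has_integral_mult_right FTC)
    moreover have "p n (-1) u = 0" for u by (simp add: p_outside)
    moreover have "p (Suc n) 0 1 = 0" "p (Suc n) 0 0 = 1" by (simp_all add: p_def Bernstein_def)
    moreover have "(-1 / (real n + 1)) * (real (Suc n) * - u) = u" for u
      by (simp add: field_simps)
    ultimately show ?case by simp
  next
    case (Suc k)
    have "((\<lambda>u. p n (int k) u - (1 / (real n + 1)) *
          (real (Suc n) * (p n (int (Suc k) - 1) u - p n (int (Suc k)) u)))
        has_integral 1 / (real n + 1) - (1 / (real n + 1)) *
          (p (Suc n) (int (Suc k)) 1 - p (Suc n) (int (Suc k)) 0)) {0..1}"
      using Suc by (intro has_integral_diff has_integral_mult_right FTC) auto
    moreover have "p (Suc n) (int (Suc k)) 1 = 0" "p (Suc n) (int (Suc k)) 0 = 0"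
      using Suc.prems by (simp_all add: p_def Bernstein_def nat_add_distrib)
    moreover have "(1 / (real n + 1)) * (real (Suc n) * u) = u" for u
      by (simp add: field_simps)
    ultimately show ?case by simp
  }
qed

text \<open>A factor \<open>u\<close> raises degree and index by one, so moments reduce to
  \<open>has_integral_p\<close>.\<close>

lemma has_integral_u_p:
  assumes "k \<le> n"
  shows "((\<lambda>u. u * p n (int k) u) has_integral (real k + 1) / ((real n + 1) * (real n + 2))) {0..1}"
proof -
  have "u * p n (int k) u = (real k + 1) / (real n + 1) * p (Suc n) (int (Suc k)) u" for u
    using p_shift_up[of "int (Suc k)" n u] by (simp add: field_simps)
  moreover have "((\<lambda>u. (real k + 1) / (real n + 1) * p (Suc n) (int (Suc k)) u) has_integral
      (real k + 1) / (real n + 1) * (1 / (real (Suc n) + 1))) {0..1}"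
    using assms by (intro has_integral_mult_right has_integral_p) auto
  ultimately show ?thesis by (simp add: algebra_simps)
qed

lemma has_integral_u2_p:
  assumes "k \<le> n"
  shows "((\<lambda>u. u\<^sup>2 * p n (int k) u) has_integral
    (real k + 1) * (real k + 2) / ((real n + 1) * (real n + 2) * (real n + 3))) {0..1}"
proof -
  have "u\<^sup>2 * p n (int k) u = (real k + 1) / (real n + 1) * (u * p (Suc n) (int (Suc k)) u)" for u
    using p_shift_up[of "int (Suc k)" n u] by (simp add: field_simps power2_eq_square)
  moreover have "((\<lambda>u. (real k + 1) / (real n + 1) * (u * p (Suc n) (int (Suc k)) u)) has_integral
      (real k + 1) / (real n + 1) * ((real (Suc k) + 1) / ((real (Suc n) + 1) * (real (Suc n) + 2)))) {0..1}"
    using assms by (intro has_integral_mult_right has_integral_u_p) auto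
  moreover have "(real k + 1) / (real n + 1) * ((real (Suc k) + 1) / ((real (Suc n) + 1) * (real (Suc n) + 2)))
    = (real k + 1) * (real k + 2) / ((real n + 1) * (real n + 2) * (real n + 3))"
    by (simp add: add_ac)
  ultimately show ?thesis by (simp only:)
qed

section \<open>An integral inequality for densities of moderate growth\<close>

text \<open>An upper bound for the ceiling of \<open>s\<close>, and at least \<open>1\<close>: this many steps of length
  \<open>\<delta>\<close> cover a distance \<open>s * \<delta>\<close>.\<close>

definition majorant :: "real \<Rightarrow> real" where
  "majorant s = (if s \<le> 1 then 1 else if s \<le> 2 then 2 else s + 1)"

text \<open>The continuous solution of
  \<open>w' + 2 * w / s = 4/3 + s^2 / 3 - majorant s\<close> with \<open>w 0 = 0\<close>. The constant \<open>1/3\<close>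
  multiplying \<open>s^2\<close> is one for which \<open>w\<close> stays nonnegative; together with a second moment
  of at most \<open>2\<close> it forces the other constant to be \<open>4/3\<close>, as \<open>4/3 + 2/3 = 2\<close>.\<close>

definition weight :: "real \<Rightarrow> real" where
  "weight s =
     (if s \<le> 1 then s / 9 + s ^ 3 / 15
      else if s \<le> 2 then s ^ 3 / 15 - 2 * s / 9 + 1 / (3 * s\<^sup>2)
      else s / 9 - s\<^sup>2 / 4 + s ^ 3 / 15 + 5 / (3 * s\<^sup>2))"

text \<open>Beyond 1, clearing the denominator \<open>s^2\<close> leaves on each piece a quintic
  with positive minimum, certified by a square times a positive cofactor.\<close>

lemma weight_nonneg:
  assumes "0 \<le> s" shows "0 \<le> weight s"
proof -
  consider "s \<le> 1" | "1 < s" "s \<le> 2" | "2 < s" by linarith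
  then show ?thesis
  proof cases
    case 1
    then show ?thesis using assms by (simp add: weight_def)
  next
    case 2
    (* The squares are centred near sqrt 2 here and near (3 + sqrt 5) / 2 below, the minima of s^2 * weight s. *)
    have "0 \<le> (s - 29/20)\<^sup>2 * (3 * s ^ 3 + 6 * (29/20) * s\<^sup>2 + 4 * (29/20)\<^sup>2 * s + 2 * (29/20) ^ 3)"
      using 2 by (intro mult_nonneg_nonneg) auto
    also have "\<dots> = 3 * s ^ 5 + 2 * (29/20) ^ 5 - 5 * (29/20)\<^sup>2 * s ^ 3"
      by (simp add: algebra_simps power2_eq_square eval_nat_numeral)
    finally have "841 * s ^ 3 \<le> 240 * s ^ 5 + 20511149 / 20000"
      by (simp add: power_divide)
    \<comment> \<open>Scaled by 80, the target reads \<open>800 * s^3 <= 240 * s^5 + 1200\<close>.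
      Since 841 exceeds 800 and the constant stays below 1200, a rational centre near the minimum
      suffices.\<close>
    then have "0 \<le> 3 * s ^ 5 - 10 * s ^ 3 + 15"
      using zero_le_power[OF assms, of 3] by linarith
    then have "0 \<le> (3 * s ^ 5 - 10 * s ^ 3 + 15) / (45 * s\<^sup>2)" by simp
    also have "\<dots> = weight s"
      using 2 by (simp add: weight_def field_simps) (simp add: eval_nat_numeral algebra_simps)
    finally show ?thesis .
  next
    case 3
    have "0 \<le> (s - 21/8)\<^sup>2 * (12 * s ^ 3 + 18 * s\<^sup>2 + (509/16) * s + 2751/64)"
      using 3 by (intro mult_nonneg_nonneg) auto
    \<comment> \<open>The cubic cofactor makes the product match this quintic in degrees 2 to 5; the
      linear remainder has positive coefficients.\<close>
    then have "0 \<le> 12 * s ^ 5 - 45 * s ^ 4 + 20 * s ^ 3 + 300"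
      using 3 by (simp add: algebra_simps power2_eq_square eval_nat_numeral)
    then have "0 \<le> (12 * s ^ 5 - 45 * s ^ 4 + 20 * s ^ 3 + 300) / (180 * s\<^sup>2)" by simp
    also have "\<dots> = weight s"
      using 3 by (simp add: weight_def field_simps) (simp add: eval_nat_numeral algebra_simps)
    finally show ?thesis .
  qed
qed

lemma continuous_on_weight: "continuous_on {0..} weight"
proof -
  have *: "{0..} = {0..1} \<union> ({1..2} \<union> {2::real..})" by auto
  have "continuous_on {0..1} weight"
    by (rule continuous_on_eq[where f = "\<lambda>s. s / 9 + s ^ 3 / 15"])
      (auto intro!: continuous_intros simp: weight_def)
  moreover have "continuous_on {1..2} weight"
    by (rule continuous_on_eq[where f = "\<lambda>s. s ^ 3 / 15 - 2 * s / 9 + 1 / (3 * s\<^sup>2)"])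
      (auto intro!: continuous_intros simp: weight_def)
  moreover have "continuous_on {2..} weight"
    by (rule continuous_on_eq[where f = "\<lambda>s. s / 9 - s\<^sup>2 / 4 + s ^ 3 / 15 + 5 / (3 * s\<^sup>2)"])
      (auto intro!: continuous_intros simp: weight_def)
  ultimately show ?thesis unfolding *
    by (intro continuous_on_closed_Un) auto
qed

text \<open>The points 1 and 2 are excluded because \<open>majorant\<close> jumps there and
  \<open>weight\<close> has a kink.\<close>

lemma DERIV_weight:
  assumes "0 < s" "s \<noteq> 1" "s \<noteq> 2"
  shows "(weight has_real_derivative 4/3 + s\<^sup>2 / 3 - majorant s - 2 * weight s / s) (at s)"
proof -
  consider "s < 1" | "1 < s" "s < 2" | "2 < s" using assms by linarith
  then show ?thesis
  proof cases
    case 1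
    have "((\<lambda>s. s / 9 + s ^ 3 / 15) has_real_derivative
        4/3 + s\<^sup>2 / 3 - majorant s - 2 * weight s / s) (at s)"
      using 1 assms by (auto intro!: derivative_eq_intros
        simp: majorant_def weight_def field_simps eval_nat_numeral)
    then show ?thesis
      by (rule has_field_derivative_transform_within_open[where S = "{..<1}"])
        (use 1 in \<open>auto simp: weight_def\<close>)
  next
    case 2
    have "((\<lambda>s. s ^ 3 / 15 - 2 * s / 9 + 1 / (3 * s\<^sup>2)) has_real_derivative
        4/3 + s\<^sup>2 / 3 - majorant s - 2 * weight s / s) (at s)"
      using 2 assms by (auto intro!: derivative_eq_intros
        simp: majorant_def weight_def field_simps eval_nat_numeral)
    then show ?thesis
      by (rule has_field_derivative_transform_within_open[where S = "{1<..<2}"])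
        (use 2 in \<open>auto simp: weight_def\<close>)
  next
    case 3
    have "((\<lambda>s. s / 9 - s\<^sup>2 / 4 + s ^ 3 / 15 + 5 / (3 * s\<^sup>2)) has_real_derivative
        4/3 + s\<^sup>2 / 3 - majorant s - 2 * weight s / s) (at s)"
      using 3 assms by (auto intro!: derivative_eq_intros
        simp: majorant_def weight_def field_simps eval_nat_numeral)
    then show ?thesis
      by (rule has_field_derivative_transform_within_open[where S = "{2<..}"])
        (use 3 in \<open>auto simp: weight_def\<close>)
  qed
qed

text \<open>The value 1/9 is the limit at 0. This quotient multiplies
  \<open>2 * F s - s * F' s\<close> in the integration by parts, and its continuity makes that term
  integrable up to 0.\<close>

lemma continuous_on_weight_div:
  "continuous_on {0..} (\<lambda>s. if s = 0 then 1/9 else weight s / s)"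
proof -
  have *: "{0..} = {0..1} \<union> {1::real..}" by auto
  have "continuous_on {0..1::real} (\<lambda>s. if s = 0 then 1/9 else weight s / s)"
    by (rule continuous_on_eq[where f = "\<lambda>s. 1/9 + s\<^sup>2 / 15"])
      (auto intro!: continuous_intros simp: weight_def field_simps eval_nat_numeral)
  moreover have "continuous_on {1..} (\<lambda>s. if s = 0 then 1/9 else weight s / s)"
    by (rule continuous_on_eq[where f = "\<lambda>s. weight s / s"])
      (auto intro!: continuous_intros continuous_on_subset[OF continuous_on_weight])
  ultimately show ?thesis unfolding *
    by (intro continuous_on_closed_Un) auto
qed

text \<open>The differential equation for \<open>weight\<close> splits the integrand into the
  derivative of \<open>\<delta> * F s * weight (s / \<delta>)\<close> and \<open>(2 * F s - s * F'
  s) * weight (s / \<delta>) / (s / \<delta>)\<close>. The first integrates to a nonnegative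
  boundary term since \<open>weight 0 = 0\<close>; the second is nonnegative by the growth
  bound.\<close>

lemma majorant_half_line:
  fixes F F' :: "real \<Rightarrow> real"
  assumes \<delta>: "0 < \<delta>" and r: "0 \<le> r"
    and F: "\<And>s. s \<in> {0..r} \<Longrightarrow> (F has_real_derivative F' s) (at s)"
    and F': "continuous_on {0..r} F'"
    and nonneg: "\<And>s. s \<in> {0..r} \<Longrightarrow> 0 \<le> F s"
    and growth: "\<And>s. s \<in> {0<..<r} \<Longrightarrow> s * F' s \<le> 2 * F s"
  shows "\<exists>I\<ge>0. ((\<lambda>s. F s * (4/3 + (s / \<delta>)\<^sup>2 / 3 - majorant (s / \<delta>))) has_integral I) {0..r}"
proof -
  define L where "L s = (if s = 0 then 1/9 else weight s / s)" for s
  have contF: "continuous_on {0..r} F"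
    by (meson DERIV_isCont F continuous_at_imp_continuous_on)
  have contL: "continuous_on {0..r} (\<lambda>s. L (s / \<delta>))"
    using \<delta> by (intro continuous_on_compose2[OF continuous_on_weight_div[folded L_def]] continuous_intros) auto
  have contW: "continuous_on {0..r} (\<lambda>s. weight (s / \<delta>))"
    using \<delta> by (intro continuous_on_compose2[OF continuous_on_weight] continuous_intros) auto
  let ?d = "\<lambda>s. \<delta> * F' s * weight (s / \<delta>)
      + F s * (4/3 + (s / \<delta>)\<^sup>2 / 3 - majorant (s / \<delta>) - 2 * L (s / \<delta>))"
  have 1: "(?d has_integral \<delta> * F r * weight (r / \<delta>) - \<delta> * F 0 * weight (0 / \<delta>)) {0..r}"
  \<comment> \<open>The exceptional points are the rescaled kinks of \<open>weight\<close>;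
    continuity is enough there.\<close>
  proof (rule fundamental_theorem_of_calculus_interior_strong[where S = "{\<delta>, 2 * \<delta>}"])
    fix s assume s: "s \<in> {0<..<r} - {\<delta>, 2 * \<delta>}"
    then have "(weight has_real_derivative 4/3 + (s / \<delta>)\<^sup>2 / 3 - majorant (s / \<delta>)
        - 2 * weight (s / \<delta>) / (s / \<delta>)) (at (s / \<delta>))"
      using \<delta> by (intro DERIV_weight) (auto simp: field_simps)
    then have "((\<lambda>s. weight (s / \<delta>)) has_real_derivative
      (4/3 + (s / \<delta>)\<^sup>2 / 3 - majorant (s / \<delta>) - 2 * weight (s / \<delta>) / (s / \<delta>)) * (1 / \<delta>)) (at s)"
      by (rule DERIV_chain2) (use \<delta> in \<open>auto intro!: derivative_eq_intros\<close>)
    then have "((\<lambda>s. weight (s / \<delta>)) has_real_derivative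
      (4/3 + (s / \<delta>)\<^sup>2 / 3 - majorant (s / \<delta>) - 2 * L (s / \<delta>)) / \<delta>) (at s)"
      using s \<delta> by (simp add: L_def mult.assoc)
    then have "((\<lambda>s. \<delta> * F s * weight (s / \<delta>)) has_real_derivative
      \<delta> * F' s * weight (s / \<delta>) +
      (4/3 + (s / \<delta>)\<^sup>2 / 3 - majorant (s / \<delta>) - 2 * L (s / \<delta>)) / \<delta> * (\<delta> * F s)) (at s)"
      using s by (intro DERIV_mult DERIV_cmult F) auto
    moreover have "X / \<delta> * (\<delta> * F s) = F s * X" for X
      using \<delta> by simp
    ultimately show "((\<lambda>s. \<delta> * F s * weight (s / \<delta>)) has_vector_derivative ?d s) (at s)"
      by (simp only: has_real_derivative_iff_has_vector_derivative)
  qed (use r in \<open>auto intro!: continuous_intros contF contW\<close>)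
  have cont2: "continuous_on {0..r} (\<lambda>s. (2 * F s - s * F' s) * L (s / \<delta>))"
    by (intro continuous_intros contF F' contL)
  then have 2: "((\<lambda>s. (2 * F s - s * F' s) * L (s / \<delta>)) has_integral
      integral {0..r} (\<lambda>s. (2 * F s - s * F' s) * L (s / \<delta>))) {0..r}"
    by (intro integrable_integral integrable_continuous_real)
  have L0: "0 \<le> L (s / \<delta>)" if "0 \<le> s" for s
    using that \<delta> by (simp add: L_def weight_nonneg)
  \<comment> \<open>The growth bound is known only in the interior, and the endpoints do not affect
    the integral.\<close>
  have "0 \<le> integral {0<..<r} (\<lambda>s. (2 * F s - s * F' s) * L (s / \<delta>))"
    using cont2 growth L0
    by (intro integral_nonneg) (auto simp: integrable_on_open_interval_real integrable_continuous_real)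
  then have pos2: "0 \<le> integral {0..r} (\<lambda>s. (2 * F s - s * F' s) * L (s / \<delta>))"
    by (simp add: integral_open_interval_real)
  have pos1: "0 \<le> \<delta> * F r * weight (r / \<delta>) - \<delta> * F 0 * weight (0 / \<delta>)"
    using \<delta> r nonneg[of r] weight_nonneg[of "r / \<delta>"] by (simp add: weight_def[of 0])
  have "?d s + (2 * F s - s * F' s) * L (s / \<delta>) =
      F s * (4/3 + (s / \<delta>)\<^sup>2 / 3 - majorant (s / \<delta>))" for s
  proof -
    have "\<delta> * weight (s / \<delta>) = s * L (s / \<delta>)"
      using \<delta> by (simp add: L_def weight_def[of 0])
    then have "\<delta> * F' s * weight (s / \<delta>) = F' s * (s * L (s / \<delta>))"
      by (metis mult.assoc mult.commute)
    then show ?thesis by (simp add: algebra_simps)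
  qed
  with has_integral_add[OF 1 2] pos1 pos2 show ?thesis
    by (intro exI[of _ "\<delta> * F r * weight (r / \<delta>) - \<delta> * F 0 * weight (0 / \<delta>) +
      integral {0..r} (\<lambda>s. (2 * F s - s * F' s) * L (s / \<delta>))"]) auto
qed

text \<open>Split at \<open>x\<close> and use the distance \<open>s\<close> from \<open>x\<close> as
  variable on either side. The growth bound takes the form needed by
  \<open>majorant_half_line\<close> on both, because reflection changes the sign of
  \<open>u - x\<close> and of the derivative together.\<close>

lemma majorant_unit_interval:
  fixes F F' :: "real \<Rightarrow> real"
  assumes \<delta>: "0 < \<delta>" and x: "x \<in> {0..1}"
    and F: "\<And>u. (F has_real_derivative F' u) (at u)"
    and F': "continuous_on UNIV F'"
    and nonneg: "\<And>u. u \<in> {0..1} \<Longrightarrow> 0 \<le> F u"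
    and growth: "\<And>u. u \<in> {0<..<1} \<Longrightarrow> (u - x) * F' u \<le> 2 * F u"
  shows "\<exists>I\<ge>0. ((\<lambda>u. F u * (4/3 + ((u - x) / \<delta>)\<^sup>2 / 3 - majorant (\<bar>u - x\<bar> / \<delta>))) has_integral I) {0..1}"
proof -
  let ?h = "\<lambda>u. F u * (4/3 + ((u - x) / \<delta>)\<^sup>2 / 3 - majorant (\<bar>u - x\<bar> / \<delta>))"
  have "\<exists>I\<ge>0. ((\<lambda>s. F (s + x) * (4/3 + (s / \<delta>)\<^sup>2 / 3 - majorant (s / \<delta>))) has_integral I) {0..1 - x}"
  proof (rule majorant_half_line[where F' = "\<lambda>s. F' (s + x)"])
    show "((\<lambda>s. F (s + x)) has_real_derivative F' (s + x)) (at s)" for s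
      by (rule DERIV_shift[THEN iffD1, OF F])
    show "continuous_on {0..1 - x} (\<lambda>s. F' (s + x))"
      by (intro continuous_on_compose2[OF F'] continuous_intros) auto
    show "s * F' (s + x) \<le> 2 * F (s + x)" if "s \<in> {0<..<1 - x}" for s
      using growth[of "s + x"] that x by simp
  qed (use \<delta> x nonneg in auto)
  then obtain I where I: "I \<ge> 0"
    "((\<lambda>s. F (s + x) * (4/3 + (s / \<delta>)\<^sup>2 / 3 - majorant (s / \<delta>))) has_integral I) {0..1 - x}"
    by blast
  have "((\<lambda>s. ?h (s + x)) has_integral I) {0..1 - x}"
    using I(2) by (rule has_integral_eq[rotated]) auto
  then have right: "(?h has_integral I) {x..1}"
    by (subst has_integral_shift_real_ivl_iff[where c = x]) simp
  have "\<exists>I\<ge>0. ((\<lambda>s. F (x - s) * (4/3 + (s / \<delta>)\<^sup>2 / 3 - majorant (s / \<delta>))) has_integral I) {0..x}"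
  proof (rule majorant_half_line[where F' = "\<lambda>s. - F' (x - s)"])
    show "((\<lambda>s. F (x - s)) has_real_derivative - F' (x - s)) (at s)" for s
    proof -
      have "((\<lambda>s. x - s) has_real_derivative - 1) (at s)"
        by (auto intro!: derivative_eq_intros)
      from DERIV_chain2[where f = F, OF F this] show ?thesis by simp
    qed
    show "continuous_on {0..x} (\<lambda>s. - F' (x - s))"
      by (intro continuous_intros continuous_on_compose2[OF F']) auto
    show "s * - F' (x - s) \<le> 2 * F (x - s)" if "s \<in> {0<..<x}" for s
      using growth[of "x - s"] that x by simp
  qed (use \<delta> x nonneg in auto)
  then obtain J where J: "J \<ge> 0"
    "((\<lambda>s. F (x - s) * (4/3 + (s / \<delta>)\<^sup>2 / 3 - majorant (s / \<delta>))) has_integral J) {0..x}"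
    by blast
  have "((\<lambda>s. ?h (- s + x)) has_integral J) {0..x}"
    using J(2) by (rule has_integral_eq[rotated]) (auto simp: power_divide)
  then have "((\<lambda>s. ?h (s + x)) has_integral J) {-x..0}"
    using has_integral_reflect_real[where f = "\<lambda>s. ?h (s + x)" and i = J and a = "-x" and b = 0] by simp
  then have left: "(?h has_integral J) {0..x}"
    by (subst has_integral_shift_real_ivl_iff[where c = x]) simp
  have "(?h has_integral J + I) {0..1}"
    using x by (intro has_integral_combine[OF _ _ left right]) auto
  with I(1) J(1) show ?thesis by (intro exI[of _ "J + I"]) auto
qed

section \<open>The kernel of the operators\<close>

text \<open>The Durrmeyer-type kernel in \<open>u\<close> against which \<open>A_op n j\<close>
  integrates \<open>f\<close>.\<close>

definition dur_kernel :: "nat \<Rightarrow> nat \<Rightarrow> real \<Rightarrow> real \<Rightarrow> real" where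
  "dur_kernel n j x u =
     (real n + 1) * (\<Sum>k=0..n. p (n - 2) (int k - int j) x * p n (int k) u)"

definition dur_kernel_deriv :: "nat \<Rightarrow> nat \<Rightarrow> real \<Rightarrow> real \<Rightarrow> real" where
  "dur_kernel_deriv n j x u =
     (real n + 1) * (\<Sum>k=0..n. p (n - 2) (int k - int j) x *
       (real n * (p (n - 1) (int k - 1) u - p (n - 1) (int k) u)))"

lemma dur_kernel_nonneg: "x \<in> {0..1} \<Longrightarrow> u \<in> {0..1} \<Longrightarrow> 0 \<le> dur_kernel n j x u"
  by (auto simp: dur_kernel_def intro!: mult_nonneg_nonneg sum_nonneg p_nonneg)

lemma continuous_on_dur_kernel_deriv: "continuous_on S (dur_kernel_deriv n j x)"
  unfolding dur_kernel_deriv_def[abs_def] by (intro continuous_intros continuous_on_p)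

lemma DERIV_dur_kernel:
  assumes "n > 0"
  shows "(dur_kernel n j x has_real_derivative dur_kernel_deriv n j x u) (at u)"
proof -
  have "(p n k has_real_derivative real n * (p (n - 1) (k - 1) u - p (n - 1) k u)) (at u)" for k
    using DERIV_p[of "n - 1" k u] assms by simp
  then show ?thesis
    unfolding dur_kernel_def[abs_def] dur_kernel_deriv_def
    by (intro DERIV_cmult DERIV_sum)
qed

text \<open>Reversing the summation index works because
  \<open>(n - k) - (2 - j) = (n - 2) - (k - j)\<close>. This symmetry reduces points left of
  \<open>x\<close> to points right of it.\<close>

lemma dur_kernel_reflect:
  assumes "j \<le> 2" "n \<ge> 2"
  shows "dur_kernel n (2 - j) (1 - x) (1 - u) = dur_kernel n j x u"
proof -
  have "(\<Sum>k=0..n. p (n - 2) (int k - int (2 - j)) (1 - x) * p n (int k) (1 - u)) =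
        (\<Sum>k=0..n. p (n - 2) (int (n - k) - int (2 - j)) (1 - x) * p n (int (n - k)) (1 - u))"
    by (subst sum.atLeastAtMost_rev) simp
  also have "\<dots> = (\<Sum>k=0..n. p (n - 2) (int k - int j) x * p n (int k) u)"
  proof (rule sum.cong[OF refl])
    fix k assume "k \<in> {0..n}"
    then have "int (n - k) - int (2 - j) = int (n - 2) - (int k - int j)"
      "int (n - k) = int n - int k" using assms by auto
    then show "p (n - 2) (int (n - k) - int (2 - j)) (1 - x) * p n (int (n - k)) (1 - u) =
      p (n - 2) (int k - int j) x * p n (int k) u"
      by (simp only: p_reflect)
  qed
  finally show ?thesis by (simp add: dur_kernel_def)
qed

lemma dur_kernel_deriv_reflect:
  assumes "j \<le> 2" "n \<ge> 2"
  shows "dur_kernel_deriv n (2 - j) (1 - x) (1 - u) = - dur_kernel_deriv n j x u"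
proof -
  have "((\<lambda>u. dur_kernel n (2 - j) (1 - x) (1 - u)) has_real_derivative
      dur_kernel_deriv n (2 - j) (1 - x) (1 - u) * - 1) (at u)"
    using assms by (intro DERIV_chain2[where g = "\<lambda>u. 1 - u", OF DERIV_dur_kernel])
      (auto intro!: derivative_eq_intros)
  moreover have "(dur_kernel n j x has_real_derivative dur_kernel_deriv n j x u) (at u)"
    using assms by (intro DERIV_dur_kernel) auto
  ultimately show ?thesis
    unfolding dur_kernel_reflect[OF assms] using DERIV_unique by fastforce
qed

section \<open>Logarithmic derivative of the kernel and its growth bound\<close>

lemma p_log_deriv:
  assumes "n > 0"
  shows "u * (1 - u) * (real n * (p (n - 1) (k - 1) u - p (n - 1) k u)) =
    (of_int k - real n * u) * p n k u"
proof -
  obtain m where m: "n = Suc m" using assms by (cases n) auto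
  have "u * (1 - u) * (real n * (p m (k - 1) u - p m k u)) =
      (1 - u) * (real (Suc m) * u * p m (k - 1) u) - u * (real (Suc m) * (1 - u) * p m k u)"
    by (simp add: m algebra_simps)
  also have "\<dots> = (1 - u) * (of_int k * p (Suc m) k u) -
      u * ((real (Suc m) - of_int k) * p (Suc m) k u)"
    unfolding p_shift_up p_shift_down ..
  finally show ?thesis by (simp add: m algebra_simps)
qed

lemma dur_kernel_log_deriv:
  assumes "n > 0"
  shows "u * (1 - u) * dur_kernel_deriv n j x u = (real n + 1) *
    (\<Sum>k=0..n. (real k - real n * u) * (p (n - 2) (int k - int j) x * p n (int k) u))"
proof -
  have "u * (1 - u) * dur_kernel_deriv n j x u = (real n + 1) *
    (\<Sum>k=0..n. p (n - 2) (int k - int j) x *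
      (u * (1 - u) * (real n * (p (n - 1) (int k - 1) u - p (n - 1) (int k) u))))"
    unfolding dur_kernel_deriv_def sum_distrib_left by (intro sum.cong) (auto simp: ac_simps)
  also have "\<dots> = (real n + 1) * (\<Sum>k=0..n. p (n - 2) (int k - int j) x *
      ((of_int (int k) - real n * u) * p n (int k) u))"
    unfolding p_log_deriv[OF assms] ..
  finally show ?thesis by (simp add: ac_simps)
qed

text \<open>Multiplying \<open>p_step\<close> in \<open>x\<close> by \<open>p_step\<close> in
  \<open>u\<close> relates \<open>w (Suc k)\<close> to \<open>w k\<close>; summing and shifting the
  index gives the identity. The term \<open>k = 0\<close> drops out through its factor
  \<open>k\<close>.\<close>

lemma dur_kernel_weight_recurrence:
  fixes x u :: real
  assumes "n \<ge> 3" "j \<le> 2"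
  defines "w \<equiv> \<lambda>k::nat. p (n - 2) (int k - int j) x * p n (int k) u"
  shows "(1 - x) * (1 - u) * (\<Sum>k=0..n. w k * (real k * (real k - real j) / (real n + 1 - real k)))
    = x * u * (\<Sum>k=0..n. w k * (real n - 2 + real j - real k))"
proof -
  obtain m where m: "n = Suc m" using assms(1) by (cases n) auto
  have step: "(1 - x) * (1 - u) * (w (Suc k) * (real (Suc k) * (real (Suc k) - real j) / (real n + 1 - real (Suc k))))
      = x * u * (w k * (real n - 2 + real j - real k))" if "k \<le> m" for k
  proof -
    have 1: "of_int (int (Suc k) - int j) * (1 - x) * p (n - 2) (int (Suc k) - int j) x =
        x * (real n - 2 + real j - real k) * p (n - 2) (int k - int j) x"
      using p_step[of "n - 2" "int (Suc k) - int j" x] assms(1)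
      by (simp add: of_nat_diff algebra_simps)
    have 2: "real (Suc k) * (1 - u) * p n (int (Suc k)) u = u * (real n - real k) * p n (int k) u"
      using p_step[of n "int (Suc k)" u] assms(1) by simp
    have nz: "real n - real k \<noteq> 0" using that m by simp
    have "(1 - x) * (1 - u) * (w (Suc k) * (real (Suc k) * (real (Suc k) - real j) / (real n + 1 - real (Suc k))))
        = (of_int (int (Suc k) - int j) * (1 - x) * p (n - 2) (int (Suc k) - int j) x) *
          (real (Suc k) * (1 - u) * p n (int (Suc k)) u) / (real n - real k)"
      by (simp add: w_def)
    also have "\<dots> = x * u * (w k * (real n - 2 + real j - real k))"
      unfolding 1 2 using nz by (simp add: w_def)
    finally show ?thesis .
  qed
  \<comment> \<open>This extends the right sum from \<open>m\<close> to \<open>n\<close>. For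
    \<open>j = 2\<close> the linear factor is 0; for \<open>j < 2\<close> the index
    \<open>n - j\<close> exceeds \<open>n - 2\<close>.\<close>
  have top: "w n * (real n - 2 + real j - real n) = 0"
    using assms(1,2) by (cases "j = 2") (auto simp: w_def p_outside)
  have "(\<Sum>k=0..n. w k * (real k * (real k - real j) / (real n + 1 - real k))) =
      (\<Sum>k=0..m. w (Suc k) * (real (Suc k) * (real (Suc k) - real j) / (real n + 1 - real (Suc k))))"
    unfolding m by (subst sum.atLeast0_atMost_Suc_shift) simp
  then have "(1 - x) * (1 - u) * (\<Sum>k=0..n. w k * (real k * (real k - real j) / (real n + 1 - real k)))
    = (\<Sum>k=0..m. (1 - x) * (1 - u) * (w (Suc k) * (real (Suc k) * (real (Suc k) - real j) / (real n + 1 - real (Suc k)))))"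
    by (simp only: sum_distrib_left)
  also have "\<dots> = (\<Sum>k=0..m. x * u * (w k * (real n - 2 + real j - real k)))"
    by (intro sum.cong refl step) auto
  also have "\<dots> = x * u * (\<Sum>k=0..m. w k * (real n - 2 + real j - real k))"
    by (simp only: sum_distrib_left)
  also have "(\<Sum>k=0..m. w k * (real n - 2 + real j - real k)) =
      (\<Sum>k=0..n. w k * (real n - 2 + real j - real k))"
    using top by (simp add: m)
  finally show ?thesis .
qed

text \<open>For fixed \<open>u\<close> the recurrence above says that \<open>\<theta> k =
  (1 - x) * (1 - u) * k * (k - j) / (n + 1 - k) - x * u * (n - 2 + j - k)\<close> has mean \<open>0\<close>
  under the weights \<open>w\<close>. As \<open>\<theta>\<close> is convex and increasing, Jensen's inequality (a tangent
  at \<open>q\<close>) bounds the mean of \<open>k\<close> by any \<open>q\<close> with \<open>\<theta> q \<ge> 0\<close>.\<close>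

lemma dur_kernel_posterior_mean:
  assumes n: "n \<ge> 3" and j: "j \<le> 2" and xu: "0 \<le> x" "x < u" "u < 1"
  defines "w \<equiv> \<lambda>k::nat. p (n - 2) (int k - int j) x * p n (int k) u"
  shows "(u - x) * (\<Sum>k=0..n. (real k - real n * u) * w k) \<le> 2 * u * (1 - u) * (\<Sum>k=0..n. w k)"
proof -
  define e where "e = u - x"
  \<comment> \<open>Chosen so that \<open>e * (q - n * u) = 2 * u * (1 - u)\<close>: the claim says
    that the mean of \<open>k\<close> is at most \<open>q\<close>, which is trivial if
    \<open>q >= n\<close>.\<close>
  define q where "q = real n * u + 2 * u * (1 - u) / e"
  have e: "0 < e" and u: "0 < u" using xu by (auto simp: e_def)
  have w0: "0 \<le> w k" for k using xu by (auto simp: w_def intro!: mult_nonneg_nonneg p_nonneg)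
  have "(\<Sum>k=0..n. w k * (real k - q)) \<le> 0"
  proof (cases "real n \<le> q")
    case True
    then show ?thesis using w0 by (intro sum_nonpos mult_nonneg_nonpos) auto
  next
    case False
    \<comment> \<open>\<open>Q > 0\<close> expresses \<open>q < n\<close>, and \<open>q\<close>,
      \<open>q - 2\<close>, \<open>n - q\<close> and \<open>d\<close> are all simple in
      \<open>Q\<close>.\<close>
    define Q where "Q = real n * e - 2 * u"
    have "2 * u * (1 - u) / e < real n * (1 - u)" using False by (simp add: q_def algebra_simps)
    then have "2 * u * (1 - u) < real n * e * (1 - u)" using e by (simp add: field_simps)
    then have Q: "0 < Q" using xu by (simp add: Q_def mult_less_cancel_right)
    define c where "c = real n + 1"
    define d where "d = c - q"
    have d: "0 < d" using False by (simp add: d_def c_def)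
    have q_eq: "q = u * (Q + 2) / e" using e by (simp add: q_def Q_def field_simps)
    have q2_eq: "q - 2 = (u * Q + 2 * x) / e" using e by (simp add: q_eq field_simps) (simp add: e_def algebra_simps)
    have nq_eq: "real n - q = (1 - u) * Q / e" using e by (simp add: q_eq Q_def field_simps)
    have d_eq: "d = ((1 - u) * Q + e) / e" using e nq_eq by (simp add: d_def c_def field_simps)
    have q2: "2 \<le> q" using q2_eq e u Q xu by (smt (verit) divide_nonneg_pos mult_nonneg_nonneg)
    \<comment> \<open>This is \<open>\<theta> q >= 0\<close> for \<open>j = 2\<close>, up to the
      positive factor restored below. That case is the worst, as \<open>\<theta> q\<close> decreases
      in \<open>j\<close>. The difference of the two sides is a polynomial in \<open>Q\<close> with
      nonnegative coefficients.\<close>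
    have "x * ((1 - u) * Q + e) * Q \<le> (1 - x) * ((Q + 2) * (u * Q + 2 * x))"
    proof -
      have "0 \<le> Q * Q * (u - x) + Q * (2 * u * (1 - x) + x * (2 - u - x)) + 4 * x * (1 - x)"
        using Q xu by (intro add_nonneg_nonneg mult_nonneg_nonneg) auto
      also have "\<dots> = (1 - x) * ((Q + 2) * (u * Q + 2 * x)) - x * ((1 - u) * Q + e) * Q"
        by (simp add: e_def algebra_simps)
      finally show ?thesis by simp
    qed
    then have "(x * ((1 - u) * Q + e) * Q) * (u * (1 - u) / (e * e)) \<le>
       ((1 - x) * ((Q + 2) * (u * Q + 2 * x))) * (u * (1 - u) / (e * e))"
      using xu e u by (intro mult_right_mono) auto
    then have key: "x * u * (d * (real n - q)) \<le> (1 - x) * (1 - u) * (q * (q - 2))"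
      unfolding q2_eq nq_eq d_eq by (simp add: q_eq ac_simps)
    have "x * u * (d * (real n - 2 + real j - q)) \<le> x * u * (d * (real n - q))"
      using j d xu u by (intro mult_left_mono) auto
    also note key
    also have "(1 - x) * (1 - u) * (q * (q - 2)) \<le> (1 - x) * (1 - u) * (q * (q - real j))"
      using j q2 xu by (intro mult_left_mono) auto
    finally have theta: "0 \<le> (1 - x) * (1 - u) * (q * (q - real j)) / d - x * u * (real n - 2 + real j - q)"
      using d by (simp add: field_simps)
    \<comment> \<open>The derivative of \<open>\<theta>\<close> at \<open>q\<close>:
      \<open>k * (k - j) / (c - k)\<close> is \<open>c * (c - j) / (c - k)\<close> plus an affine
      function of \<open>k\<close> with slope -1.\<close>
    define slope where "slope = (1 - x) * (1 - u) * (c * (c - real j) / d\<^sup>2 - 1) + x * u"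
    have "d\<^sup>2 < c * (c - real j)"
    proof -
      have "d * d \<le> d * (c - real j)" using q2 j d by (intro mult_left_mono) (auto simp: d_def)
      also have "\<dots> < c * (c - real j)"
        using q2 j n by (intro mult_strict_right_mono) (auto simp: d_def c_def)
      finally show ?thesis by (simp add: power2_eq_square)
    qed
    then have slope: "0 < slope"
      unfolding slope_def using d xu u by (intro add_pos_nonneg mult_pos_pos) (auto simp: field_simps)
    have tangent: "q * (q - real j) / d + (c * (c - real j) / d\<^sup>2 - 1) * (real k - q)
        \<le> real k * (real k - real j) / (real n + 1 - real k)" if "k \<le> n" for k
    proof -
      have ck: "0 < c - real k" using that by (simp add: c_def)
      have cj: "0 \<le> c" "real j \<le> c" using j n by (simp_all add: c_def)
      have "real k * (real k - real j) / (c - real k) -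
          (q * (q - real j) / d + (c * (c - real j) / d\<^sup>2 - 1) * (real k - q)) =
          c * (c - real j) * (real k - q)\<^sup>2 / ((c - real k) * d\<^sup>2)"
      proof -
        have q: "q = c - d" and kq: "real k - (c - d) = d - (c - real k)"
          by (simp_all add: d_def)
        define b where "b = c - real k"
        have b: "b \<noteq> 0" "d \<noteq> 0" using ck d by (auto simp: b_def)
        have "(c - b) * (c - b - real j) / b -
          ((c - d) * (c - d - real j) / d + (c * (c - real j) / d\<^sup>2 - 1) * (d - b)) =
          c * (c - real j) * (d - b)\<^sup>2 / (b * d\<^sup>2)"
          using b by (simp add: divide_simps) (simp add: algebra_simps power2_eq_square)
        then show ?thesis by (simp add: b_def q kq)
      qed
      also have "\<dots> \<ge> 0" using ck cj by (intro divide_nonneg_nonneg mult_nonneg_nonneg) auto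
      finally show ?thesis by (simp add: c_def)
    qed
    \<comment> \<open>Termwise
      \<open>slope * (k - q) <= \<theta> k - \<theta> q <= \<theta> k\<close>, and the weighted sum
      of \<open>\<theta> k\<close> is 0.\<close>
    have "slope * (\<Sum>k=0..n. w k * (real k - q)) = (\<Sum>k=0..n. w k * (slope * (real k - q)))"
      by (simp add: sum_distrib_left ac_simps)
    also have "\<dots> \<le> (\<Sum>k=0..n. (1 - x) * (1 - u) *
         (w k * (real k * (real k - real j) / (real n + 1 - real k))) -
        x * u * (w k * (real n - 2 + real j - real k)))"
    proof (rule sum_mono)
      fix k assume "k \<in> {0..n}"
      then have "(1 - x) * (1 - u) * (q * (q - real j) / d + (c * (c - real j) / d\<^sup>2 - 1) * (real k - q))
        \<le> (1 - x) * (1 - u) * (real k * (real k - real j) / (real n + 1 - real k))"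
        using xu by (intro mult_left_mono tangent) auto
      then have "slope * (real k - q) \<le> (1 - x) * (1 - u) *
         (real k * (real k - real j) / (real n + 1 - real k)) - x * u * (real n - 2 + real j - real k)"
        using theta unfolding slope_def by (simp add: algebra_simps)
      from mult_left_mono[OF this w0[of k]]
      show "w k * (slope * (real k - q)) \<le> (1 - x) * (1 - u) *
         (w k * (real k * (real k - real j) / (real n + 1 - real k))) -
        x * u * (w k * (real n - 2 + real j - real k))"
        by (simp add: right_diff_distrib ac_simps)
    qed
    also have "\<dots> = 0"
      unfolding w_def sum_subtractf sum_distrib_left[symmetric]
      by (simp only: dur_kernel_weight_recurrence[OF n j] diff_self)
    finally show ?thesis using slope by (simp add: mult_le_0_iff)
  qed
  then have "(\<Sum>k=0..n. (real k - real n * u) * w k) \<le> (q - real n * u) * (\<Sum>k=0..n. w k)"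
    by (simp add: algebra_simps sum_subtractf sum_distrib_left)
  then have "e * (\<Sum>k=0..n. (real k - real n * u) * w k) \<le> e * ((q - real n * u) * (\<Sum>k=0..n. w k))"
    using e by (intro mult_left_mono) auto
  also have "\<dots> = 2 * u * (1 - u) * (\<Sum>k=0..n. w k)" using e by (simp add: q_def)
  finally show ?thesis by (simp add: e_def)
qed

lemma dur_kernel_growth_right:
  assumes "n \<ge> 3" "j \<le> 2" "0 \<le> x" "x < u" "u < 1"
  shows "(u - x) * dur_kernel_deriv n j x u \<le> 2 * dur_kernel n j x u"
proof -
  have pos: "0 < u * (1 - u)" using assms by auto
  have "u * (1 - u) * ((u - x) * dur_kernel_deriv n j x u) = (u - x) * (u * (1 - u) * dur_kernel_deriv n j x u)"
    by simp
  also have "\<dots> = (real n + 1) * ((u - x) *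
      (\<Sum>k=0..n. (real k - real n * u) * (p (n - 2) (int k - int j) x * p n (int k) u)))"
    using assms by (subst dur_kernel_log_deriv) auto
  also have "\<dots> \<le> (real n + 1) * (2 * u * (1 - u) *
      (\<Sum>k=0..n. p (n - 2) (int k - int j) x * p n (int k) u))"
    by (intro mult_left_mono dur_kernel_posterior_mean assms) auto
  also have "\<dots> = u * (1 - u) * (2 * dur_kernel n j x u)" by (simp add: dur_kernel_def)
  finally show ?thesis using pos by (simp only: mult_le_cancel_left_pos)
qed

text \<open>Left of \<open>x\<close>, the bound is the right-hand one for the reflected
  kernel.\<close>

lemma dur_kernel_growth:
  assumes "n \<ge> 3" "j \<le> 2" "x \<in> {0..1}" "u \<in> {0<..<1}"
  shows "(u - x) * dur_kernel_deriv n j x u \<le> 2 * dur_kernel n j x u"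
proof -
  consider "x < u" | "x = u" | "u < x" by linarith
  then show ?thesis
  proof cases
    case 1
    then show ?thesis using assms by (intro dur_kernel_growth_right) auto
  next
    case 2
    then show ?thesis using assms dur_kernel_nonneg[of x u n j] by simp
  next
    case 3
    have "(1 - u - (1 - x)) * dur_kernel_deriv n (2 - j) (1 - x) (1 - u) \<le> 2 * dur_kernel n (2 - j) (1 - x) (1 - u)"
      using assms 3 by (intro dur_kernel_growth_right) auto
    then show ?thesis
      using assms by (simp add: dur_kernel_reflect dur_kernel_deriv_reflect algebra_simps)
  qed
qed

section \<open>Moments and moduli of continuity\<close>

lemma sum_shifted_p:
  assumes "n \<ge> 2" "j \<le> 2"
  shows "(\<Sum>k=0..n. p (n - 2) (int k - int j) x * h k) =
    (\<Sum>m\<le>n - 2. Bernstein (n - 2) m x * h (m + j))"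
proof -
  have "(\<Sum>k=0..n. p (n - 2) (int k - int j) x * h k) =
      (\<Sum>k=0 + j..(n - 2) + j. p (n - 2) (int k - int j) x * h k)"
    using assms by (intro sum.mono_neutral_right) (auto intro!: p_outside)
  also have "\<dots> = (\<Sum>m=0..n - 2. p (n - 2) (int (m + j) - int j) x * h (m + j))"
    by (rule sum.shift_bounds_cl_nat_ivl)
  also have "\<dots> = (\<Sum>m\<le>n - 2. Bernstein (n - 2) m x * h (m + j))"
    by (intro sum.cong) (auto simp: p_of_nat)
  finally show ?thesis .
qed

lemma Bernstein_quadratic_mean:
  "(\<Sum>m\<le>n. Bernstein n m x * (\<alpha> * (real m * (real m - 1)) + \<beta> * real m + \<gamma>)) =
    \<alpha> * (real n * (real n - 1) * x\<^sup>2) + \<beta> * (real n * x) + \<gamma>"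
proof -
  have "(\<Sum>m\<le>n. Bernstein n m x * (\<alpha> * (real m * (real m - 1)) + \<beta> * real m + \<gamma>)) =
    \<alpha> * (\<Sum>m\<le>n. real m * (real m - 1) * Bernstein n m x) +
    \<beta> * (\<Sum>m\<le>n. real m * Bernstein n m x) + \<gamma> * (\<Sum>m\<le>n. Bernstein n m x)"
    by (simp only: sum_distrib_left sum.distrib[symmetric]) (intro sum.cong; simp add: algebra_simps)
  then show ?thesis by simp
qed

lemma has_integral_dur_kernel:
  assumes "n \<ge> 2" "j \<le> 2"
  shows "(dur_kernel n j x has_integral 1) {0..1}"
proof -
  have "(dur_kernel n j x has_integral
      (real n + 1) * (\<Sum>k=0..n. p (n - 2) (int k - int j) x * (1 / (real n + 1)))) {0..1}"
    unfolding dur_kernel_def[abs_def]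
    by (intro has_integral_mult_right has_integral_sum has_integral_p) auto
  then show ?thesis
    unfolding sum_shifted_p[OF assms] by (simp add: sum_divide_distrib[symmetric])
qed

lemma has_integral_dur_kernel_moment:
  assumes n: "n \<ge> 2" and j: "j \<le> 2"
  shows "((\<lambda>u. dur_kernel n j x u * (u - x)\<^sup>2) has_integral
    ((real n - 2) * (real n - 3) * x\<^sup>2 + (2 * real j + 4) * ((real n - 2) * x) +
      (real j + 1) * (real j + 2) - 2 * x * (real n + 3) * ((real n - 2) * x + real j + 1)) /
    ((real n + 2) * (real n + 3)) + x\<^sup>2) {0..1}"
proof -
  define D where "D = (real n + 2) * (real n + 3)"
  have 1: "((\<lambda>u. (real n + 1) * (\<Sum>k=0..n. p (n - 2) (int k - int j) x *
      (u\<^sup>2 * p n (int k) u - 2 * x * (u * p n (int k) u) + x\<^sup>2 * p n (int k) u))) has_integral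
    (real n + 1) * (\<Sum>k=0..n. p (n - 2) (int k - int j) x *
      ((real k + 1) * (real k + 2) / ((real n + 1) * (real n + 2) * (real n + 3)) -
       2 * x * ((real k + 1) / ((real n + 1) * (real n + 2))) + x\<^sup>2 * (1 / (real n + 1))))) {0..1}"
    by (intro has_integral_mult_right has_integral_sum has_integral_add has_integral_diff
        has_integral_p has_integral_u_p has_integral_u2_p) auto
  have 2: "(\<lambda>u. (real n + 1) * (\<Sum>k=0..n. p (n - 2) (int k - int j) x *
      (u\<^sup>2 * p n (int k) u - 2 * x * (u * p n (int k) u) + x\<^sup>2 * p n (int k) u))) =
      (\<lambda>u. dur_kernel n j x u * (u - x)\<^sup>2)"
    unfolding dur_kernel_def sum_distrib_left sum_distrib_right
    by (intro ext sum.cong) (auto simp: power2_eq_square algebra_simps)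
  have "(real n + 1) * (\<Sum>k=0..n. p (n - 2) (int k - int j) x *
      ((real k + 1) * (real k + 2) / ((real n + 1) * (real n + 2) * (real n + 3)) -
       2 * x * ((real k + 1) / ((real n + 1) * (real n + 2))) + x\<^sup>2 * (1 / (real n + 1)))) =
    (\<Sum>k=0..n. p (n - 2) (int k - int j) x *
      ((real k + 1) * (real k + 2) / D - 2 * x * (real k + 1) / (real n + 2) + x\<^sup>2))"
    unfolding sum_distrib_left
  proof (rule sum.cong[OF refl])
    fix k
    have pull: "A * (P * T) = P * U" if "A * T = U" for A P T U :: real
      using that by (simp add: mult.left_commute)
    have cancel: "A * (X / (A * B * C) - 2 * x * (Y / (A * B)) + x\<^sup>2 * (1 / A)) =
      X / (B * C) - 2 * x * Y / B + x\<^sup>2" if "A \<noteq> 0" for A B C X Y :: real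
      using that by (simp add: distrib_left right_diff_distrib)
    have "(real n + 1) * ((real k + 1) * (real k + 2) / ((real n + 1) * (real n + 2) * (real n + 3)) -
       2 * x * ((real k + 1) / ((real n + 1) * (real n + 2))) + x\<^sup>2 * (1 / (real n + 1))) =
      (real k + 1) * (real k + 2) / D - 2 * x * (real k + 1) / (real n + 2) + x\<^sup>2"
      unfolding D_def by (rule cancel) simp
    then show "(real n + 1) * (p (n - 2) (int k - int j) x * ((real k + 1) * (real k + 2) / ((real n + 1) * (real n + 2) * (real n + 3)) -
       2 * x * ((real k + 1) / ((real n + 1) * (real n + 2))) + x\<^sup>2 * (1 / (real n + 1)))) =
      p (n - 2) (int k - int j) x * ((real k + 1) * (real k + 2) / D - 2 * x * (real k + 1) / (real n + 2) + x\<^sup>2)"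
      by (rule pull)
  qed
  \<comment> \<open>Factorial powers suit the binomial moments: \<open>(m + j + 1) * (m + j + 2) = m
    * (m - 1) + (2 * j + 4) * m + (j + 1) * (j + 2)\<close>.\<close>
  also have "\<dots> = (\<Sum>m\<le>n - 2. Bernstein (n - 2) m x *
      (1 / D * (real m * (real m - 1)) + ((2 * real j + 4) - 2 * x * (real n + 3)) / D * real m +
       (((real j + 1) * (real j + 2) - 2 * x * (real n + 3) * (real j + 1)) / D + x\<^sup>2)))"
    unfolding sum_shifted_p[OF n j]
  proof (rule sum.cong[OF refl])
    fix m
    have e: "2 * x * (real (m + j) + 1) / (real n + 2) = 2 * x * (real n + 3) * (real (m + j) + 1) / D"
      by (simp add: D_def divide_simps)
    have "(real (m + j) + 1) * (real (m + j) + 2) / D - 2 * x * (real (m + j) + 1) / (real n + 2) + x\<^sup>2 =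
      1 / D * (real m * (real m - 1)) + ((2 * real j + 4) - 2 * x * (real n + 3)) / D * real m +
       (((real j + 1) * (real j + 2) - 2 * x * (real n + 3) * (real j + 1)) / D + x\<^sup>2)"
      unfolding e by (simp add: algebra_simps add_divide_distrib diff_divide_distrib)
    then show "Bernstein (n - 2) m x * ((real (m + j) + 1) * (real (m + j) + 2) / D - 2 * x * (real (m + j) + 1) / (real n + 2) + x\<^sup>2) =
     Bernstein (n - 2) m x * (1 / D * (real m * (real m - 1)) + ((2 * real j + 4) - 2 * x * (real n + 3)) / D * real m +
       (((real j + 1) * (real j + 2) - 2 * x * (real n + 3) * (real j + 1)) / D + x\<^sup>2))"
      by (simp only:)
  qed
  also have "\<dots> = ((real n - 2) * (real n - 3) * x\<^sup>2 + (2 * real j + 4) * ((real n - 2) * x) +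
      (real j + 1) * (real j + 2) - 2 * x * (real n + 3) * ((real n - 2) * x + real j + 1)) / D + x\<^sup>2"
  proof -
    have N: "real (n - 2) = real n - 2" using n by simp
    show ?thesis
      unfolding Bernstein_quadratic_mean N
      by (simp add: algebra_simps add_divide_distrib diff_divide_distrib)
  qed
  finally show ?thesis using 1 unfolding 2 D_def by (simp only:)
qed

text \<open>Replacing \<open>n\<close> by 3 only lowers the numerator; completing the square then
  leaves 5/9 in both branches.\<close>

lemma
  assumes "n \<ge> 3" "x \<in> {0..1}"
  shows delta_pos: "0 < delta n x"
    and delta_square: "(delta n x)\<^sup>2 = (if x \<le> 1/2 then (6 - 17 * x + 12 * x\<^sup>2) + real n * phi2 x
       else (1 - 7 * x + 12 * x\<^sup>2) + real n * phi2 x) / ((real n + 2) * (real n + 3))"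
proof -
  have phi: "3 * (x * (1 - x)) \<le> real n * phi2 x"
    unfolding phi2_def using assms by (intro mult_right_mono) auto
  have "0 < (if x \<le> 1/2 then (6 - 17 * x + 12 * x\<^sup>2) + real n * phi2 x
       else (1 - 7 * x + 12 * x\<^sup>2) + real n * phi2 x)"
  proof -
    have "0 \<le> (3 * x - 7/3)\<^sup>2" "0 \<le> (3 * x - 2/3)\<^sup>2" by simp_all
    then show ?thesis using phi by (auto simp: power2_eq_square algebra_simps)
  qed
  then have pos: "0 < (if x \<le> 1/2 then (6 - 17 * x + 12 * x\<^sup>2) + real n * phi2 x
       else (1 - 7 * x + 12 * x\<^sup>2) + real n * phi2 x) / ((real n + 2) * (real n + 3))"
    by (intro divide_pos_pos) auto
  then show "0 < delta n x" by (simp add: delta_def)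
  show "(delta n x)\<^sup>2 = (if x \<le> 1/2 then (6 - 17 * x + 12 * x\<^sup>2) + real n * phi2 x
       else (1 - 7 * x + 12 * x\<^sup>2) + real n * phi2 x) / ((real n + 2) * (real n + 3))"
    unfolding delta_def using pos by (intro real_sqrt_pow2) auto
qed

text \<open>Over \<open>(n + 2) * (n + 3)\<close>, the moment has numerator \<open>2 * n * phi2 x +
  24 * x^2 - (10 * j + 14) * x + (j + 1) * (j + 2)\<close>. Twice the branches of
  \<open>delta\<close> are exactly the cases \<open>j = 2\<close> and \<open>j = 0\<close>, each the
  largest of the three on its half of the interval.\<close>

lemma dur_kernel_second_moment:
  assumes n: "n \<ge> 3" and j: "j \<le> 2" and x: "x \<in> {0..1}"
  obtains m where "((\<lambda>u. dur_kernel n j x u * (u - x)\<^sup>2) has_integral m) {0..1}"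
    "m \<le> 2 * (delta n x)\<^sup>2"
proof
  show "((\<lambda>u. dur_kernel n j x u * (u - x)\<^sup>2) has_integral
    ((real n - 2) * (real n - 3) * x\<^sup>2 + (2 * real j + 4) * ((real n - 2) * x) +
      (real j + 1) * (real j + 2) - 2 * x * (real n + 3) * ((real n - 2) * x + real j + 1)) /
    ((real n + 2) * (real n + 3)) + x\<^sup>2) {0..1}"
    using n by (intro has_integral_dur_kernel_moment j) auto
  let ?A = "(real n - 2) * (real n - 3) * x\<^sup>2 + (2 * real j + 4) * ((real n - 2) * x) +
      (real j + 1) * (real j + 2) - 2 * x * (real n + 3) * ((real n - 2) * x + real j + 1)"
  let ?N = "if x \<le> 1/2 then (6 - 17 * x + 12 * x\<^sup>2) + real n * phi2 x
       else (1 - 7 * x + 12 * x\<^sup>2) + real n * phi2 x"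
  let ?D = "(real n + 2) * (real n + 3)"
  have D: "0 < ?D" by simp
  have "j = 0 \<or> j = 1 \<or> j = 2" using j by auto
  then have "?A + x\<^sup>2 * ?D \<le> 2 * ?N"
    by (elim disjE) (auto simp: phi2_def power2_eq_square algebra_simps)
  then have "(?A + x\<^sup>2 * ?D) / ?D \<le> 2 * ?N / ?D"
    using D by (intro divide_right_mono) auto
  also have "(?A + x\<^sup>2 * ?D) / ?D = ?A / ?D + x\<^sup>2" using D by (simp add: add_divide_distrib)
  finally show "?A / ?D + x\<^sup>2 \<le> 2 * (delta n x)\<^sup>2"
    unfolding delta_square[OF n x] by simp
qed

lemma has_integral_A_op:
  assumes "continuous_on {0..1} f"
  shows "((\<lambda>u. dur_kernel n j x u * f u) has_integral A_op n j f x) {0..1}"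
proof -
  have "((\<lambda>u. p n (int k) u * f u) has_integral integral {0..1} (\<lambda>u. p n (int k) u * f u)) {0..1}" for k
    by (intro integrable_integral integrable_continuous_real continuous_intros continuous_on_p assms)
  then have "((\<lambda>u. (real n + 1) * (\<Sum>k=0..n. p (n - 2) (int k - int j) x * (p n (int k) u * f u)))
      has_integral A_op n j f x) {0..1}"
    unfolding A_op_def by (intro has_integral_mult_right has_integral_sum) auto
  then show ?thesis by (simp add: dur_kernel_def sum_distrib_left sum_distrib_right ac_simps)
qed

section \<open>Modulus of continuity and the bound for each \<open>A_op\<close>\<close>

lemma modcont_bdd_above:
  fixes f :: "real \<Rightarrow> real"
  assumes "continuous_on {0..1} f"
  shows "bdd_above {\<bar>f s - f t\<bar> | s t. s \<in> {0..1} \<and> t \<in> {0..1::real} \<and> \<bar>s - t\<bar> \<le> \<delta>}"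
proof -
  obtain B where "\<forall>y\<in>f ` {0..1}. norm y \<le> B"
    using compact_imp_bounded[OF compact_continuous_image[OF assms compact_Icc]]
    unfolding bounded_iff by blast
  then have B: "\<bar>f s\<bar> \<le> B" if "s \<in> {0..1}" for s using that by auto
  have "\<bar>f s - f t\<bar> \<le> 2 * B" if "s \<in> {0..1}" "t \<in> {0..1}" for s t
    using B[OF that(1)] B[OF that(2)] by linarith
  then show ?thesis by (intro bdd_aboveI[of _ "2 * B"]) auto
qed

lemma modcont_upper:
  assumes "continuous_on {0..1} f" "s \<in> {0..1}" "t \<in> {0..1}" "\<bar>s - t\<bar> \<le> \<delta>"
  shows "\<bar>f s - f t\<bar> \<le> modcont f \<delta>"
  unfolding modcont_def using assms by (intro cSup_upper modcont_bdd_above) auto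

lemma modcont_nonneg:
  assumes "continuous_on {0..1} f" "0 \<le> \<delta>"
  shows "0 \<le> modcont f \<delta>"
  using modcont_upper[OF assms(1), of 0 0 \<delta>] assms(2) by simp

text \<open>Cut the segment from \<open>s\<close> to \<open>t\<close> into \<open>N\<close> equal
  steps, which stay in the unit interval by convexity.\<close>

lemma modcont_multiple:
  assumes f: "continuous_on {0..1} f" and \<delta>: "0 \<le> \<delta>"
    and st: "s \<in> {0..1}" "t \<in> {0..1}" "\<bar>s - t\<bar> \<le> real N * \<delta>"
  shows "\<bar>f s - f t\<bar> \<le> real N * modcont f \<delta>"
proof (cases "N = 0")
  case True
  then show ?thesis using st by simp
next
  case False
  define g where "g i = s + (t - s) * (real i / real N)" for i
  have g01: "g i \<in> {0..1}" if "i \<le> N" for i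
  proof -
    have "g i = (1 - real i / real N) * s + (real i / real N) * t"
      by (simp add: g_def algebra_simps diff_divide_distrib)
    also have "\<dots> \<in> {0..1}"
      using convexD[OF convex_real_interval(5)[of 0 1] st(1,2), of "1 - real i / real N" "real i / real N"]
        that False by simp
    finally show ?thesis .
  qed
  have step: "\<bar>g i - g (Suc i)\<bar> \<le> \<delta>" for i
  proof -
    have "g i - g (Suc i) = (s - t) / real N"
      using False by (simp add: g_def field_simps)
    then have "\<bar>g i - g (Suc i)\<bar> = \<bar>s - t\<bar> / real N" by simp
    then show ?thesis using st(3) False by (simp add: pos_divide_le_eq mult.commute)
  qed
  have "\<bar>f (g 0) - f (g i)\<bar> \<le> real i * modcont f \<delta>" if "i \<le> N" for i
    using that
  proof (induction i)
    case (Suc i)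
    have "\<bar>f (g i) - f (g (Suc i))\<bar> \<le> modcont f \<delta>"
      using Suc.prems by (intro modcont_upper f g01 step) auto
    with Suc show ?case by (simp add: algebra_simps)
  qed simp
  from this[of N] show ?thesis using False by (simp add: g_def)
qed

text \<open>Some natural number lies between \<open>r\<close> and \<open>majorant r\<close>: 1, 2,
  or the ceiling of \<open>r\<close>, according to the branch.\<close>

lemma modcont_majorant:
  assumes f: "continuous_on {0..1} f" and \<delta>: "0 < \<delta>" and "s \<in> {0..1}" "t \<in> {0..1}"
  shows "\<bar>f s - f t\<bar> \<le> modcont f \<delta> * majorant (\<bar>s - t\<bar> / \<delta>)"
proof -
  define r where "r = \<bar>s - t\<bar> / \<delta>"
  have r: "0 \<le> r" "\<bar>s - t\<bar> = r * \<delta>" using \<delta> by (auto simp: r_def)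
  obtain N :: nat where N: "r \<le> real N" "real N \<le> majorant r"
  proof -
    consider "r \<le> 1" | "1 < r" "r \<le> 2" | "2 < r" by linarith
    then show ?thesis
    proof cases
      case 1
      then show ?thesis by (intro that[of 1]) (auto simp: majorant_def)
    next
      case 2
      then show ?thesis by (intro that[of 2]) (auto simp: majorant_def)
    next
      case 3
      then show ?thesis by (intro that[of "nat \<lceil>r\<rceil>"]) (auto simp: majorant_def)
    qed
  qed
  have "\<bar>f s - f t\<bar> \<le> real N * modcont f \<delta>"
    using r N \<delta> by (intro modcont_multiple assms) auto
  also have "\<dots> \<le> majorant r * modcont f \<delta>"
    using N \<delta> by (intro mult_right_mono modcont_nonneg f) auto
  finally show ?thesis by (simp add: r_def mult.commute)
qed

lemma A_op_bound:
  assumes f: "continuous_on {0..1} f" and n: "n \<ge> 3" and j: "j \<le> 2" and x: "x \<in> {0..1}"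
  shows "\<bar>A_op n j f x - f x\<bar> \<le> 2 * modcont f (delta n x)"
proof -
  let ?K = "dur_kernel n j x"
  define d where "d = delta n x"
  define \<omega> where "\<omega> = modcont f d"
  have d: "0 < d" using delta_pos[OF n x] by (simp add: d_def)
  have \<omega>: "0 \<le> \<omega>" unfolding \<omega>_def using d by (intro modcont_nonneg f) auto
  obtain m where m: "((\<lambda>u. ?K u * (u - x)\<^sup>2) has_integral m) {0..1}" "m \<le> 2 * d\<^sup>2"
    using dur_kernel_second_moment[OF n j x] unfolding d_def by blast
  obtain I where I: "0 \<le> I" "((\<lambda>u. ?K u * (4/3 + ((u - x) / d)\<^sup>2 / 3 - majorant (\<bar>u - x\<bar> / d)))
      has_integral I) {0..1}"
    using majorant_unit_interval[of d x ?K "dur_kernel_deriv n j x"] d x n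
      DERIV_dur_kernel[of n j x] continuous_on_dur_kernel_deriv dur_kernel_nonneg[OF x] dur_kernel_growth[OF n j x]
    by auto
  have one: "(?K has_integral 1) {0..1}" using n j by (intro has_integral_dur_kernel) auto
  \<comment> \<open>Subtracting the integral \<open>I\<close> yields integrability of the
    discontinuous \<open>majorant\<close> term along with its mean, which is at most
    \<open>4/3 + 2/3 = 2\<close>.\<close>
  have "((\<lambda>u. (4/3) * ?K u + 1 / (3 * d\<^sup>2) * (?K u * (u - x)\<^sup>2) -
      ?K u * (4/3 + ((u - x) / d)\<^sup>2 / 3 - majorant (\<bar>u - x\<bar> / d))) has_integral
      (4/3) * 1 + 1 / (3 * d\<^sup>2) * m - I) {0..1}"
    by (intro has_integral_diff has_integral_add has_integral_mult_right one m I)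
  then have maj: "((\<lambda>u. ?K u * majorant (\<bar>u - x\<bar> / d)) has_integral
      4/3 + 1 / (3 * d\<^sup>2) * m - I) {0..1}"
    by (simp add: power_divide algebra_simps)
  have "1 / (3 * d\<^sup>2) * m \<le> 1 / (3 * d\<^sup>2) * (2 * d\<^sup>2)"
    using m(2) by (intro mult_left_mono) auto
  then have le2: "4/3 + 1 / (3 * d\<^sup>2) * m - I \<le> 2" using I(1) d by simp
  have diff: "((\<lambda>u. ?K u * f u - f x * ?K u) has_integral A_op n j f x - f x * 1) {0..1}"
    by (intro has_integral_diff has_integral_mult_right has_integral_A_op f one)
  have "norm (integral {0..1} (\<lambda>u. ?K u * f u - f x * ?K u)) \<le>
      integral {0..1} (\<lambda>u. \<omega> * (?K u * majorant (\<bar>u - x\<bar> / d)))"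
  proof (rule integral_norm_bound_integral)
    show "(\<lambda>u. ?K u * f u - f x * ?K u) integrable_on {0..1}" using diff by blast
    show "(\<lambda>u. \<omega> * (?K u * majorant (\<bar>u - x\<bar> / d))) integrable_on {0..1}"
      using has_integral_mult_right[OF maj] by blast
    fix u :: real assume u: "u \<in> {0..1}"
    have "\<bar>f u - f x\<bar> \<le> \<omega> * majorant (\<bar>u - x\<bar> / d)"
      unfolding \<omega>_def by (intro modcont_majorant f d u x)
    then have "?K u * \<bar>f u - f x\<bar> \<le> ?K u * (\<omega> * majorant (\<bar>u - x\<bar> / d))"
      by (intro mult_left_mono dur_kernel_nonneg x u)
    moreover have "\<bar>?K u * f u - f x * ?K u\<bar> = ?K u * \<bar>f u - f x\<bar>"
    proof -
      have "?K u * f u - f x * ?K u = ?K u * (f u - f x)" by (simp add: algebra_simps)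
      then show ?thesis using dur_kernel_nonneg[OF x u, of n j] by (simp add: abs_mult)
    qed
    ultimately show "norm (?K u * f u - f x * ?K u) \<le> \<omega> * (?K u * majorant (\<bar>u - x\<bar> / d))"
      by (simp add: ac_simps)
  qed
  also have "integral {0..1} (\<lambda>u. ?K u * f u - f x * ?K u) = A_op n j f x - f x"
    using integral_unique[OF diff] by simp
  also have "integral {0..1} (\<lambda>u. \<omega> * (?K u * majorant (\<bar>u - x\<bar> / d))) =
      \<omega> * (4/3 + 1 / (3 * d\<^sup>2) * m - I)"
    by (intro integral_unique has_integral_mult_right maj)
  also have "\<dots> \<le> \<omega> * 2" using le2 \<omega> by (intro mult_left_mono)
  finally show ?thesis by (simp add: \<omega>_def d_def)
qed

section \<open>Estimates for the full operator\<close>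

lemma D_op_bound:
  assumes norm: "(\<Sum>j=0..2. coef a b c d j x n) = 1"
    and f: "continuous_on {0..1} f" and n: "n \<ge> 3" and x: "x \<in> {0..1}"
  shows "\<bar>D_op a b c d n f x - f x\<bar> \<le> 2 * M2 a b c d x n * modcont f (delta n x)"
proof -
  \<comment> \<open>The normalisation distributes \<open>f x\<close> over the three
    operators.\<close>
  have "D_op a b c d n f x - f x = (\<Sum>j=0..2. coef a b c d j x n * A_op n j f x) -
      (\<Sum>j=0..2. coef a b c d j x n) * f x"
    by (simp add: D_op_def norm)
  also have "\<dots> = (\<Sum>j=0..2. coef a b c d j x n * (A_op n j f x - f x))"
    by (simp add: sum_distrib_right sum_subtractf right_diff_distrib)
  finally have "\<bar>D_op a b c d n f x - f x\<bar> \<le> (\<Sum>j=0..2. \<bar>coef a b c d j x n * (A_op n j f x - f x)\<bar>)"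
    by (simp only: sum_abs)
  also have "\<dots> \<le> (\<Sum>j=0..2. \<bar>coef a b c d j x n\<bar> * (2 * modcont f (delta n x)))"
    unfolding abs_mult by (intro sum_mono mult_left_mono A_op_bound f n x) auto
  also have "\<dots> = M2 a b c d x n * (2 * modcont f (delta n x))"
    by (simp only: M2_def sum_distrib_right)
  finally show ?thesis by (simp add: ac_simps)
qed

text \<open>Where \<open>phi2\<close> is at least \<open>m > 0\<close>, the additive 6 is absorbed
  by \<open>n * phi2 x * (6 / m)\<close>. So \<open>delta\<close> is at most \<open>N\<close> times
  the new step, \<open>N <= N^2\<close> moving the factor out of the square root.\<close>

lemma modcont_delta_le:
  assumes f: "continuous_on {0..1} f" and n: "n \<ge> 3" and x: "x \<in> {0..1}"
    and m: "0 < m" "m \<le> phi2 x" and N: "6 / m + 1 \<le> real N"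
  shows "modcont f (delta n x) \<le> real N * modcont f (sqrt (phi2 x / real n))"
proof -
  have num: "(if x \<le> 1/2 then (6 - 17 * x + 12 * x\<^sup>2) + real n * phi2 x
       else (1 - 7 * x + 12 * x\<^sup>2) + real n * phi2 x) \<le> 6 + real n * phi2 x"
  proof -
    have "x * x \<le> x" using x mult_left_le[of x x] by auto
    then show ?thesis using x by (auto simp: power2_eq_square)
  qed
  have N1: "1 \<le> real N" using N m by (smt (verit) divide_pos_pos)
  have "(delta n x)\<^sup>2 \<le> (6 + real n * phi2 x) / ((real n + 2) * (real n + 3))"
    unfolding delta_square[OF n x] using num by (intro divide_right_mono) auto
  also have "\<dots> \<le> (6 + real n * phi2 x) / (real n * real n)"
    using n m by (intro divide_left_mono) (auto intro!: mult_mono)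
  also have "\<dots> \<le> (real n * phi2 x * (6 / m) + real n * phi2 x) / (real n * real n)"
  proof -
    have "6 = m * (6 / m)" using m by simp
    also have "\<dots> \<le> real n * phi2 x * (6 / m)"
    proof (intro mult_right_mono)
      have "m * 1 \<le> phi2 x * real n" using m n by (intro mult_mono) auto
      then show "m \<le> real n * phi2 x" by (simp add: mult.commute)
    qed (use m in auto)
    finally show ?thesis by (intro divide_right_mono) auto
  qed
  also have "\<dots> = (6 / m + 1) * (phi2 x / real n)"
    using n by (simp add: field_simps)
  also have "\<dots> \<le> real N * (phi2 x / real n)"
    using N m by (intro mult_right_mono) auto
  also have "\<dots> \<le> (real N)\<^sup>2 * (phi2 x / real n)"
    using N1 m by (intro mult_right_mono) (auto simp: power2_eq_square)
  also have "\<dots> = (real N * sqrt (phi2 x / real n))\<^sup>2"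
    using m by (simp add: power_mult_distrib)
  finally have le: "delta n x \<le> real N * sqrt (phi2 x / real n)"
    by (rule power2_le_imp_le) (use m in auto)
  show ?thesis
    unfolding modcont_def[of f "delta n x"]
  proof (rule cSup_least)
    show "{\<bar>f s - f t\<bar> | s t. s \<in> {0..1} \<and> t \<in> {0..1} \<and> \<bar>s - t\<bar> \<le> delta n x} \<noteq> {}"
      using delta_pos[OF n x] by (auto intro!: exI[of _ 0])
    show "v \<le> real N * modcont f (sqrt (phi2 x / real n))"
      if v: "v \<in> {\<bar>f s - f t\<bar> | s t. s \<in> {0..1} \<and> t \<in> {0..1} \<and> \<bar>s - t\<bar> \<le> delta n x}" for v
    proof -
      obtain s t where st: "v = \<bar>f s - f t\<bar>" "s \<in> {0..1}" "t \<in> {0..1}" "\<bar>s - t\<bar> \<le> delta n x"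
        using v by blast
      have "0 \<le> sqrt (phi2 x / real n)" using m by simp
      then show ?thesis
        unfolding st(1) using order_trans[OF st(4) le] by (intro modcont_multiple f st)
    qed
  qed
qed

text \<open>The second estimate lives on compact subintervals of (0,1): at an endpoint its right
  side is 0, as \<open>phi2\<close> vanishes there. The constant may depend on the subinterval and
  the coefficients, but not on \<open>f\<close>, \<open>n\<close> or \<open>x\<close>.\<close>

theorem theorem4:
  fixes a b c d :: "nat \<Rightarrow> real"
  assumes norm: "\<And>n x. n \<ge> 3 \<Longrightarrow> x \<in> {0..1} \<Longrightarrow> (\<Sum>j=0..2. coef a b c d j x n) = 1"
  shows "(\<forall>f :: real \<Rightarrow> real. continuous_on {0..1} f \<longrightarrow>
            (\<forall>n\<ge>3. \<forall>x\<in>{0..1}.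
               \<bar>D_op a b c d n f x - f x\<bar> \<le> 2 * M2 a b c d x n * modcont f (delta n x)))
       \<and> (\<forall>\<alpha> \<beta> :: real. 0 < \<alpha> \<and> \<alpha> \<le> \<beta> \<and> \<beta> < 1 \<longrightarrow>
            (\<forall>j\<in>{0..2}. bounded {coef a b c d j x n | x n. x \<in> {\<alpha>..\<beta>} \<and> n \<ge> 3}) \<longrightarrow>
            (\<exists>C :: real. \<forall>f :: real \<Rightarrow> real. continuous_on {0..1} f \<longrightarrow>
               (\<forall>n\<ge>3. \<forall>x\<in>{\<alpha>..\<beta>}.
                  \<bar>D_op a b c d n f x - f x\<bar> \<le> C * modcont f (sqrt (phi2 x / real n)))))"
proof (rule conjI)
  show "\<forall>f :: real \<Rightarrow> real. continuous_on {0..1} f \<longrightarrow>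
            (\<forall>n\<ge>3. \<forall>x\<in>{0..1}.
               \<bar>D_op a b c d n f x - f x\<bar> \<le> 2 * M2 a b c d x n * modcont f (delta n x))"
    by (intro allI impI ballI D_op_bound norm)
  show "\<forall>\<alpha> \<beta> :: real. 0 < \<alpha> \<and> \<alpha> \<le> \<beta> \<and> \<beta> < 1 \<longrightarrow>
            (\<forall>j\<in>{0..2}. bounded {coef a b c d j x n | x n. x \<in> {\<alpha>..\<beta>} \<and> n \<ge> 3}) \<longrightarrow>
            (\<exists>C :: real. \<forall>f :: real \<Rightarrow> real. continuous_on {0..1} f \<longrightarrow>
               (\<forall>n\<ge>3. \<forall>x\<in>{\<alpha>..\<beta>}.
                  \<bar>D_op a b c d n f x - f x\<bar> \<le> C * modcont f (sqrt (phi2 x / real n))))"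
  proof (intro allI impI)
    fix \<alpha> \<beta> :: real
    assume \<alpha>\<beta>: "0 < \<alpha> \<and> \<alpha> \<le> \<beta> \<and> \<beta> < 1"
    define S where "S j = {coef a b c d j x n | x n. x \<in> {\<alpha>..\<beta>} \<and> n \<ge> 3}" for j
    assume "\<forall>j\<in>{0..2}. bounded {coef a b c d j x n | x n. x \<in> {\<alpha>..\<beta>} \<and> n \<ge> 3}"
    then have "\<forall>j\<in>{0..2}. \<exists>B. \<forall>v\<in>S j. \<bar>v\<bar> \<le> B"
      unfolding S_def[symmetric] bounded_iff real_norm_def .
    from bchoice[OF this] obtain B where B: "\<And>j v. j \<in> {0..2} \<Longrightarrow> v \<in> S j \<Longrightarrow> \<bar>v\<bar> \<le> B j"
      by blast
    define m where "m = \<alpha> * (1 - \<beta>)"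
    have m: "0 < m" using \<alpha>\<beta> by (simp add: m_def)
    obtain N :: nat where N: "6 / m + 1 \<le> real N" using real_arch_simple by blast
    show "\<exists>C :: real. \<forall>f :: real \<Rightarrow> real. continuous_on {0..1} f \<longrightarrow>
               (\<forall>n\<ge>3. \<forall>x\<in>{\<alpha>..\<beta>}.
                  \<bar>D_op a b c d n f x - f x\<bar> \<le> C * modcont f (sqrt (phi2 x / real n)))"
    proof (intro exI[of _ "2 * (\<Sum>j=0..2. B j) * real N"] allI impI ballI)
      fix f :: "real \<Rightarrow> real" and n :: nat and x :: real
      assume f: "continuous_on {0..1} f" and n: "3 \<le> n" and x: "x \<in> {\<alpha>..\<beta>}"
      have x01: "x \<in> {0..1}" using x \<alpha>\<beta> by auto
      have phi: "m \<le> phi2 x" unfolding m_def phi2_def using x \<alpha>\<beta> by (intro mult_mono) auto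
      have M2: "M2 a b c d x n \<le> (\<Sum>j=0..2. B j)"
        unfolding M2_def using n x by (intro sum_mono B) (auto simp: S_def)
      have "0 \<le> M2 a b c d x n" by (simp add: M2_def sum_nonneg)
      with M2 have B0: "0 \<le> (\<Sum>j=0..2. B j)" by linarith
      have "\<bar>D_op a b c d n f x - f x\<bar> \<le> 2 * M2 a b c d x n * modcont f (delta n x)"
        by (intro D_op_bound norm f n x01)
      also have "\<dots> \<le> 2 * (\<Sum>j=0..2. B j) * modcont f (delta n x)"
        using M2 delta_pos[OF n x01] by (intro mult_right_mono modcont_nonneg f) auto
      also have "\<dots> \<le> 2 * (\<Sum>j=0..2. B j) * (real N * modcont f (sqrt (phi2 x / real n)))"
        using B0 by (intro mult_left_mono modcont_delta_le[OF f n x01 m phi N]) auto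
      finally show "\<bar>D_op a b c d n f x - f x\<bar> \<le>
          2 * (\<Sum>j=0..2. B j) * real N * modcont f (sqrt (phi2 x / real n))"
        by (simp add: mult.assoc)
    qed
  qed
qed

end
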